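(* Let $I\subset\mathbb{R}$ and let $\varepsilon_0\in\mathbb{R}$ be a limit point of $I$. For every $\varepsilon\in I\setminus\{\varepsilon_0\}$ let $\mathcal{D}_\varepsilon$ be a collection of families of nonempty subsets of $X$ indexed by $\mathbb{R}\times\Omega$, and let $\varphi_\varepsilon$ be a continuous cocycle on $X$ over $\mathbb{R}$ and $(\Omega,\mathcal{F},P,\{\vartheta_t\}_{t\in\mathbb{R}})$ having a $\mathcal{D}_\varepsilon$-pullback attractor $\mathcal{A}_\varepsilon\in\mathcal{D}_\varepsilon$ in $X\cap Y$ (i.e. both in $X$ and in $Y$). Let $\varphi_{\varepsilon_0}$ be a deterministic non-autonomous continuous cocycle on $X$ over $\mathbb{R}$, $\mathcal{D}_{\varepsilon_0}$ a collection of families $\{B(\tau);\tau\in\mathbb{R}\}$ of nonempty subsets of $X$, and $\mathcal{A}_{\varepsilon_0}=\{\mathcal{A}_{\varepsilon_0}(\tau);\tau\in\mathbb{R}\}\in\mathcal{D}_{\varepsilon_0}$ a $\mathcal{D}_{\varepsilon_0}$-pullback attractor of $\varphi_{\varepsilon_0}$ in $X\cap Y$ (i.e. both in $X$ and in $Y$). Consider the conditions: (C1) for every $t\in\mathbb{R}^+$, $\tau\in\mathbb{R}$, $\omega\in\Omega$, every sequence $\varepsilon_n\in I\setminus\{\varepsilon_0\}$ with $\varepsilon_n\to\varepsilon_0$, and $x_n,x\in X$ with $x_n\to x$ in $X$, $\lim_{n\to\infty}\varphi_{\varepsilon_n}(t,\tau-t,\vartheta_{-t}\omega,x_n)=\varphi_{\varepsilon_0}(t,\tau-t,x)$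 in $X$; (C2) there is a map $R'_{\varepsilon_0}:\mathbb{R}\to\mathbb{R}$ such that the family $B'_0=\{B'_0(\tau)=\{x\in X:\|x\|_X\le R'_{\varepsilon_0}(\tau)\};\tau\in\mathbb{R}\}$ belongs to $\mathcal{D}_{\varepsilon_0}$; (C3) for every $\varepsilon\in I\setminus\{\varepsilon_0\}$, $\varphi_\varepsilon$ has a closed measurable $\mathcal{D}_\varepsilon$-pullback absorbing set $K_\varepsilon=\{K_\varepsilon(\tau,\omega)\}\in\mathcal{D}_\varepsilon$ in $X$ such that for every $\tau\in\mathbb{R}$, $\omega\in\Omega$, $\limsup_{\varepsilon\to\varepsilon_0}\|K_\varepsilon(\tau,\omega)\|_X\le R'_{\varepsilon_0}(\tau)$; (C4) for every $\tau,\omega$, $\bigcup_{\varepsilon\in I\setminus\{\varepsilon_0\}}\mathcal{A}_\varepsilon(\tau,\omega)$ is precompact in $X$; (C5) for every $\tau,\omega$, $\bigcup_{\varepsilon\in I\setminus\{\varepsilon_0\}}\mathcal{A}_\varepsilon(\tau,\omega)$ is precompact in $Y$. If (C1)–(C4) hold, then for each $\tau\in\mathbb{R}$, $\omega\in\Omega$, $$\lim_{\varepsilon\to\varepsilon_0}\mathrm{dist}_X(\mathcal{A}_\varepsilon(\tau,\omega),\mathcal{A}_{\varepsilon_0}(\tau))=0.$$ If further (C5) holds, all the cocycles $\varphi_\varepsilon$ ($\varepsilon\in I\setminus\{\varepsilon_0\}$) and $\varphi_{\varepsilon_0}$ map $X$ into $X\cap Y$ for every $t>0$ (and all $\tau,\omega$),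 and convergence of a sequence $\{x_n\}\subset X\cap Y$ to $x$ in $X$ and to $y$ in $Y$ implies $x=y$, then for each $\tau\in\mathbb{R}$, $\omega\in\Omega$, $$\lim_{\varepsilon\to\varepsilon_0}\mathrm{dist}_Y(\mathcal{A}_\varepsilon(\tau,\omega),\mathcal{A}_{\varepsilon_0}(\tau))=0.$$
   Context: $(X,\|\cdot\|_X)$ and $(Y,\|\cdot\|_Y)$ are complete separable Banach spaces with $X\cap Y\neq\emptyset$; no inclusion between them is assumed. $\mathbb{R}^+=[0,\infty)$. For $S\subset X$, $\|S\|_X=\sup_{x\in S}\|x\|_X$. $(\Omega,\mathcal{F},P,\{\vartheta_t\}_{t\in\mathbb{R}})$ is a measurable dynamical system: a probability space with a (jointly measurable) group $\vartheta_t$ of measure preserving transformations. Cocycle: a family of measurable mappings $\varphi:\mathbb{R}^+\times\mathbb{R}\times\Omega\times X\to X$ (i.e. $\varphi(\cdot,\tau,\cdot,\cdot)$ is $(\mathcal{B}(\mathbb{R}^+)\times\mathcal{F}\times\mathcal{B}(X),\mathcal{B}(X))$-measurable for each $\tau$) such that for all $\tau,\omega$, $t,s\in\mathbb{R}^+$: $\varphi(0,\tau,\omega,\cdot)$ is the identity on $X$, and $\varphi(t+s,\tau,\omega,\cdot)=\varphi(t,\tau+s,\vartheta_s\omega,\cdot)\circ\varphi(s,\tau,\omega,\cdot)$. It is continuous if each $\varphi(t,\tau,\omega,\cdot):X\to X$ is continuous. A deterministic non-autonomous continuous cocycle on $X$ over $\mathbb{R}$ is a map $\varphi_{\varepsilon_0}:\mathbb{R}^+\times\mathbb{R}\times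 X\to X$ with $\varphi_{\varepsilon_0}(0,\tau,\cdot)$ the identity, $\varphi_{\varepsilon_0}(t+s,\tau,\cdot)=\varphi_{\varepsilon_0}(t,\tau+s,\cdot)\circ\varphi_{\varepsilon_0}(s,\tau,\cdot)$, and $\varphi_{\varepsilon_0}(t,\tau,\cdot):X\to X$ continuous. $\mathrm{dist}_X(A,B)=\sup_{a\in A}\inf_{b\in B}\|a-b\|_X$ is the Hausdorff semi-metric (similarly $\mathrm{dist}_Y$). A family $K$ is measurable in $X$ if $\omega\mapsto\mathrm{dist}_X(x,K(\tau,\omega))$ is measurable w.r.t. the $P$-completion of $\mathcal{F}$ for every $x\in X$, $\tau\in\mathbb{R}$; it is closed if each $K(\tau,\omega)$ is closed and nonempty. $K\in\mathcal{D}$ is a $\mathcal{D}$-pullback absorbing set for $\varphi$ in $X$ if for all $\tau,\omega$ and $B\in\mathcal{D}$ there is $T=T(\tau,\omega,B)>0$ with $\varphi(t,\tau-t,\vartheta_{-t}\omega,B(\tau-t,\vartheta_{-t}\omega))\subseteq K(\tau,\omega)$ for all $t\ge T$. $\mathcal{A}\in\mathcal{D}$ is a $\mathcal{D}$-pullback attractor for $\varphi$ in $X$ (resp. in $Y$) if (1) $\mathcal{A}$ is measurable in $X$ w.r.t. the $P$-completion of $\mathcal{F}$ and each $\mathcal{A}(\tau,\omega)$ is compact in $X$ (resp. $Y$); (2) $\varphi(t,\tau,\omega,\mathcal{A}(\tau,\omega))=\mathcal{A}(\tau+t,\vartheta_t\omega)$ for all $t\ge0,\tau,\omega$; (3) for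 every $B\in\mathcal{D}$ and all $\tau,\omega$, $\lim_{t\to\infty}\mathrm{dist}_X(\varphi(t,\tau-t,\vartheta_{-t}\omega,B(\tau-t,\vartheta_{-t}\omega)),\mathcal{A}(\tau,\omega))=0$ (resp. with $\mathrm{dist}_Y$). For the deterministic cocycle, $\mathcal{A}_{\varepsilon_0}\in\mathcal{D}_{\varepsilon_0}$ is a $\mathcal{D}_{\varepsilon_0}$-pullback attractor in $X$ (resp. $Y$) if each $\mathcal{A}_{\varepsilon_0}(\tau)$ is compact in $X$ (resp. $Y$), $\varphi_{\varepsilon_0}(t,\tau,\mathcal{A}_{\varepsilon_0}(\tau))=\mathcal{A}_{\varepsilon_0}(\tau+t)$ for $t\ge0$, and $\mathrm{dist}_X(\varphi_{\varepsilon_0}(t,\tau-t,B(\tau-t)),\mathcal{A}_{\varepsilon_0}(\tau))\to0$ as $t\to\infty$ for each $B\in\mathcal{D}_{\varepsilon_0}$, $\tau\in\mathbb{R}$ (resp. with $\mathrm{dist}_Y$). *)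

theory Defs
  imports "HOL-Probability.Probability"
begin

locale measurable_dynamical_system = prob_space M
  for M :: "'w measure" and \<theta> :: "real \<Rightarrow> 'w \<Rightarrow> 'w" +
  assumes shift_measurable: "(\<lambda>(t, \<omega>). \<theta> t \<omega>) \<in> borel \<Otimes>\<^sub>M M \<rightarrow>\<^sub>M M"
    and shift_zero: "\<omega> \<in> space M \<Longrightarrow> \<theta> 0 \<omega> = \<omega>"
    and shift_add: "\<omega> \<in> space M \<Longrightarrow> \<theta> (s + t) \<omega> = \<theta> s (\<theta> t \<omega>)"
    and shift_preserving: "distr M M (\<theta> t) = M"

text \<open>
  The space \<open>\<Omega>\<close> is \<^term>\<open>space M\<close>. Maps and families of sets are total functions, and only
  their values at times \<open>t \<ge> 0\<close> and at points of \<^term>\<open>space M\<close> are constrained.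
\<close>

definition continuous_cocycle ::
  "'w measure \<Rightarrow> (real \<Rightarrow> 'w \<Rightarrow> 'w) \<Rightarrow> (real \<Rightarrow> real \<Rightarrow> 'w \<Rightarrow> 'x::banach \<Rightarrow> 'x) \<Rightarrow> bool" where
  "continuous_cocycle M \<theta> \<phi> \<longleftrightarrow>
     (\<forall>\<tau>. (\<lambda>(t, \<omega>, x). \<phi> t \<tau> \<omega> x)
        \<in> restrict_space borel {0..} \<Otimes>\<^sub>M (M \<Otimes>\<^sub>M borel) \<rightarrow>\<^sub>M borel) \<and>
     (\<forall>\<tau>. \<forall>\<omega>\<in>space M. \<forall>x. \<phi> 0 \<tau> \<omega> x = x) \<and>
     (\<forall>t\<ge>0. \<forall>s\<ge>0. \<forall>\<tau>. \<forall>\<omega>\<in>space M. \<phi> (t + s) \<tau> \<omega> = \<phi> t (\<tau> + s) (\<theta> s \<omega>) \<circ> \<phi> s \<tau> \<omega>) \<and>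
     (\<forall>t\<ge>0. \<forall>\<tau>. \<forall>\<omega>\<in>space M. continuous_on UNIV (\<phi> t \<tau> \<omega>))"

definition deterministic_continuous_cocycle ::
  "(real \<Rightarrow> real \<Rightarrow> 'x::banach \<Rightarrow> 'x) \<Rightarrow> bool" where
  "deterministic_continuous_cocycle \<phi> \<longleftrightarrow>
     (\<forall>\<tau> x. \<phi> 0 \<tau> x = x) \<and>
     (\<forall>t\<ge>0. \<forall>s\<ge>0. \<forall>\<tau>. \<phi> (t + s) \<tau> = \<phi> t (\<tau> + s) \<circ> \<phi> s \<tau>) \<and>
     (\<forall>t\<ge>0. \<forall>\<tau>. continuous_on UNIV (\<phi> t \<tau>))"

text \<open>The suprema may be infinite, hence the extended real values.\<close>

definition set_norm :: "'x::real_normed_vector set \<Rightarrow> ereal" where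
  "set_norm S = (SUP x\<in>S. ereal (norm x))"

definition semidist :: "'x::real_normed_vector set \<Rightarrow> 'x set \<Rightarrow> ereal" where
  "semidist A B = (SUP a\<in>A. INF b\<in>B. ereal (norm (a - b)))"

text \<open>
  No inclusion between the Banach spaces \<open>X\<close> and \<open>Y\<close> is assumed, so they are two types
  \<open>'x\<close> and \<open>'y\<close>, realised as subsets of a common universe \<open>'u\<close> by injections \<open>iX\<close> and \<open>iY\<close>.
  Thus \<open>X \<inter> Y\<close> is \<^term>\<open>range iX \<inter> range iY\<close>. A set \<open>S \<subseteq> X\<close> is contained in \<open>Y\<close> iff
  \<open>contained_in_Y iX iY S\<close>, and \<open>trace_in_Y iX iY S\<close> is \<open>S \<inter> Y\<close> regarded as a subset of \<open>Y\<close>.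
\<close>

definition contained_in_Y :: "('x \<Rightarrow> 'u) \<Rightarrow> ('y \<Rightarrow> 'u) \<Rightarrow> 'x set \<Rightarrow> bool" where
  "contained_in_Y iX iY S \<longleftrightarrow> iX ` S \<subseteq> range iY"

definition trace_in_Y :: "('x \<Rightarrow> 'u) \<Rightarrow> ('y \<Rightarrow> 'u) \<Rightarrow> 'x set \<Rightarrow> 'y set" where
  "trace_in_Y iX iY S = {y. iY y \<in> iX ` S}"

definition measurable_family ::
  "'w measure \<Rightarrow> (real \<Rightarrow> 'w \<Rightarrow> 'x::real_normed_vector set) \<Rightarrow> bool" where
  "measurable_family M K \<longleftrightarrow>
     (\<forall>x \<tau>. (\<lambda>\<omega>. semidist {x} (K \<tau> \<omega>)) \<in> borel_measurable (completion M))"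

definition closed_family ::
  "'w measure \<Rightarrow> (real \<Rightarrow> 'w \<Rightarrow> 'x::real_normed_vector set) \<Rightarrow> bool" where
  "closed_family M K \<longleftrightarrow> (\<forall>\<tau>. \<forall>\<omega>\<in>space M. closed (K \<tau> \<omega>) \<and> K \<tau> \<omega> \<noteq> {})"

definition pullback_absorbing ::
  "'w measure \<Rightarrow> (real \<Rightarrow> 'w \<Rightarrow> 'w) \<Rightarrow> (real \<Rightarrow> real \<Rightarrow> 'w \<Rightarrow> 'x \<Rightarrow> 'x) \<Rightarrow>
   (real \<Rightarrow> 'w \<Rightarrow> 'x set) set \<Rightarrow> (real \<Rightarrow> 'w \<Rightarrow> 'x set) \<Rightarrow> bool" where
  "pullback_absorbing M \<theta> \<phi> D K \<longleftrightarrow>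
     K \<in> D \<and>
     (\<forall>\<tau>. \<forall>\<omega>\<in>space M. \<forall>B\<in>D. \<exists>T>0. \<forall>t\<ge>T.
        \<phi> t (\<tau> - t) (\<theta> (- t) \<omega>) ` B (\<tau> - t) (\<theta> (- t) \<omega>) \<subseteq> K \<tau> \<omega>)"

definition pullback_attractor_X ::
  "'w measure \<Rightarrow> (real \<Rightarrow> 'w \<Rightarrow> 'w) \<Rightarrow> (real \<Rightarrow> real \<Rightarrow> 'w \<Rightarrow> 'x::banach \<Rightarrow> 'x) \<Rightarrow>
   (real \<Rightarrow> 'w \<Rightarrow> 'x set) set \<Rightarrow> (real \<Rightarrow> 'w \<Rightarrow> 'x set) \<Rightarrow> bool" where
  "pullback_attractor_X M \<theta> \<phi> D A \<longleftrightarrow>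
     A \<in> D \<and> measurable_family M A \<and>
     (\<forall>\<tau>. \<forall>\<omega>\<in>space M. compact (A \<tau> \<omega>)) \<and>
     (\<forall>t\<ge>0. \<forall>\<tau>. \<forall>\<omega>\<in>space M. \<phi> t \<tau> \<omega> ` A \<tau> \<omega> = A (\<tau> + t) (\<theta> t \<omega>)) \<and>
     (\<forall>B\<in>D. \<forall>\<tau>. \<forall>\<omega>\<in>space M.
        ((\<lambda>t. semidist (\<phi> t (\<tau> - t) (\<theta> (- t) \<omega>) ` B (\<tau> - t) (\<theta> (- t) \<omega>)) (A \<tau> \<omega>))
           \<longlongrightarrow> 0) at_top)"

text \<open>
  The semi-distance in \<open>Y\<close> of a pulled-back set to the attractor is only meaningful when that set
  lies in \<open>Y\<close>; attraction in \<open>Y\<close> therefore includes that this holds for all large \<open>t\<close>.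
\<close>

definition pullback_attractor_Y ::
  "('x \<Rightarrow> 'u) \<Rightarrow> ('y::banach \<Rightarrow> 'u) \<Rightarrow>
   'w measure \<Rightarrow> (real \<Rightarrow> 'w \<Rightarrow> 'w) \<Rightarrow> (real \<Rightarrow> real \<Rightarrow> 'w \<Rightarrow> 'x::banach \<Rightarrow> 'x) \<Rightarrow>
   (real \<Rightarrow> 'w \<Rightarrow> 'x set) set \<Rightarrow> (real \<Rightarrow> 'w \<Rightarrow> 'x set) \<Rightarrow> bool" where
  "pullback_attractor_Y iX iY M \<theta> \<phi> D A \<longleftrightarrow>
     A \<in> D \<and> measurable_family M A \<and>
     (\<forall>\<tau>. \<forall>\<omega>\<in>space M. contained_in_Y iX iY (A \<tau> \<omega>) \<and> compact (trace_in_Y iX iY (A \<tau> \<omega>))) \<and>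
     (\<forall>t\<ge>0. \<forall>\<tau>. \<forall>\<omega>\<in>space M. \<phi> t \<tau> \<omega> ` A \<tau> \<omega> = A (\<tau> + t) (\<theta> t \<omega>)) \<and>
     (\<forall>B\<in>D. \<forall>\<tau>. \<forall>\<omega>\<in>space M.
        (\<forall>\<^sub>F t in at_top.
           contained_in_Y iX iY (\<phi> t (\<tau> - t) (\<theta> (- t) \<omega>) ` B (\<tau> - t) (\<theta> (- t) \<omega>))) \<and>
        ((\<lambda>t. semidist
                (trace_in_Y iX iY (\<phi> t (\<tau> - t) (\<theta> (- t) \<omega>) ` B (\<tau> - t) (\<theta> (- t) \<omega>)))
                (trace_in_Y iX iY (A \<tau> \<omega>)))
           \<longlongrightarrow> 0) at_top)"

definition deterministic_pullback_attractor_X ::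
  "(real \<Rightarrow> real \<Rightarrow> 'x::banach \<Rightarrow> 'x) \<Rightarrow> (real \<Rightarrow> 'x set) set \<Rightarrow> (real \<Rightarrow> 'x set) \<Rightarrow> bool" where
  "deterministic_pullback_attractor_X \<phi> D A \<longleftrightarrow>
     A \<in> D \<and>
     (\<forall>\<tau>. compact (A \<tau>)) \<and>
     (\<forall>t\<ge>0. \<forall>\<tau>. \<phi> t \<tau> ` A \<tau> = A (\<tau> + t)) \<and>
     (\<forall>B\<in>D. \<forall>\<tau>. ((\<lambda>t. semidist (\<phi> t (\<tau> - t) ` B (\<tau> - t)) (A \<tau>)) \<longlongrightarrow> 0) at_top)"

definition deterministic_pullback_attractor_Y ::
  "('x \<Rightarrow> 'u) \<Rightarrow> ('y::banach \<Rightarrow> 'u) \<Rightarrow>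
   (real \<Rightarrow> real \<Rightarrow> 'x::banach \<Rightarrow> 'x) \<Rightarrow> (real \<Rightarrow> 'x set) set \<Rightarrow> (real \<Rightarrow> 'x set) \<Rightarrow> bool" where
  "deterministic_pullback_attractor_Y iX iY \<phi> D A \<longleftrightarrow>
     A \<in> D \<and>
     (\<forall>\<tau>. contained_in_Y iX iY (A \<tau>) \<and> compact (trace_in_Y iX iY (A \<tau>))) \<and>
     (\<forall>t\<ge>0. \<forall>\<tau>. \<phi> t \<tau> ` A \<tau> = A (\<tau> + t)) \<and>
     (\<forall>B\<in>D. \<forall>\<tau>.
        (\<forall>\<^sub>F t in at_top. contained_in_Y iX iY (\<phi> t (\<tau> - t) ` B (\<tau> - t))) \<and>
        ((\<lambda>t. semidist (trace_in_Y iX iY (\<phi> t (\<tau> - t) ` B (\<tau> - t)))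
                (trace_in_Y iX iY (A \<tau>))) \<longlongrightarrow> 0) at_top)"

end

theory Submission
  imports Defs
begin

text \<open>
  By compactness it suffices that every limit \<open>a\<close> of points \<open>a\<^sub>n \<in> \<A>\<^bsub>\<epsilon>\<^sub>n\<^esub>(\<tau>, \<omega>)\<close> with
  \<open>\<epsilon>\<^sub>n \<rightarrow> \<epsilon>\<^sub>0\<close> lies in \<open>\<A>\<^sub>0(\<tau>)\<close>. For each \<open>t \<ge> 0\<close>, invariance pulls \<open>a\<^sub>n\<close> back to points of
  the attractors at time \<open>\<tau> - t\<close>; along a subsequence these converge to some \<open>x\<close>, the convergence
  of the cocycles gives \<open>a = \<phi>\<^sub>0(t, \<tau> - t, x)\<close>, and the bound on the absorbing sets puts \<open>x\<close> into
  the ball \<open>B'\<^sub>0(\<tau> - t)\<close>. Since \<open>\<A>\<^sub>0\<close> attracts these balls and is closed, \<open>a \<in> \<A>\<^sub>0(\<tau>)\<close>. In \<open>Y\<close> one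
  extracts a further subsequence and identifies the two limits.
\<close>

section \<open>Convergent subsequences, traces in Y, and the Hausdorff semi-distance\<close>

lemma precompact_convergent_subseq:
  fixes S :: "'a::metric_space set" and x :: "nat \<Rightarrow> 'a"
  assumes "compact (closure S)" and "\<And>n. x n \<in> S"
  obtains r :: "nat \<Rightarrow> nat" and l where "strict_mono r" "(x \<circ> r) \<longlonglongrightarrow> l"
proof -
  have "\<forall>n. x n \<in> closure S" using assms(2) closure_subset by blast
  with assms(1) have "\<exists>l\<in>closure S. \<exists>r. strict_mono r \<and> (x \<circ> r) \<longlonglongrightarrow> l"
    unfolding compact_def by simp
  with that show thesis by blast
qed

lemma trace_in_Y_nonempty:
  assumes "contained_in_Y iX iY S" and "S \<noteq> {}"
  shows "trace_in_Y iX iY S \<noteq> {}"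
proof -
  obtain x where x: "x \<in> S" using assms(2) by blast
  with assms(1) obtain y where "iX x = iY y" unfolding contained_in_Y_def by blast
  with x have "y \<in> trace_in_Y iX iY S" unfolding trace_in_Y_def by (auto intro: rev_image_eqI)
  then show ?thesis by blast
qed

text \<open>In the extended reals the supremum over the empty set is minus infinity, so
  \<open>A\<close> must have a point; an empty \<open>B\<close> is harmless, its infimum being plus
  infinity.\<close>

lemma semidist_nonneg:
  assumes "A \<noteq> {}"
  shows "0 \<le> semidist A B"
proof -
  obtain a where "a \<in> A" using assms by auto
  moreover have "0 \<le> (INF b\<in>B. ereal (norm (a - b)))"
    by (intro INF_greatest) auto
  ultimately show ?thesis
    unfolding semidist_def by (rule SUP_upper2)
qed

text \<open>Sequential criterion serving both the X and the Y statement. If the semi-distance stayed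
  away from 0 along some sequence of parameters, points chosen in the sets would stay a fixed
  distance from \<open>B\<close>, so none of their subsequences could converge into
  \<open>B\<close>. A limit is demanded along a subsequence only, which is what precompactness
  supplies. Nonemptiness gives the lower bound 0.\<close>

lemma semidist_tendsto_zeroI:
  fixes A :: "real \<Rightarrow> 'a::real_normed_vector set"
  assumes nonempty: "\<And>e. e \<in> I - {e0} \<Longrightarrow> A e \<noteq> {}"
    and limits: "\<And>e a. (\<And>n::nat. e n \<in> I - {e0}) \<Longrightarrow> e \<longlonglongrightarrow> e0 \<Longrightarrow> (\<And>n. a n \<in> A (e n)) \<Longrightarrow>
        \<exists>r l. strict_mono (r :: nat \<Rightarrow> nat) \<and> (a \<circ> r) \<longlonglongrightarrow> l \<and> l \<in> B"
  shows "((\<lambda>e. semidist (A e) B) \<longlongrightarrow> 0) (at e0 within I)"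
  unfolding tendsto_at_iff_sequentially
proof (intro allI impI)
  fix e :: "nat \<Rightarrow> real"
  assume eI: "\<forall>n. e n \<in> I - {e0}" and e: "e \<longlonglongrightarrow> e0"
  show "((\<lambda>e. semidist (A e) B) \<circ> e) \<longlonglongrightarrow> 0"
  proof (rule order_tendstoI)
    fix c :: ereal assume "c < 0"
    then have "c < semidist (A (e n)) B" for n
      using semidist_nonneg[OF nonempty, of "e n" B] eI by (meson less_le_trans)
    then show "\<forall>\<^sub>F n in sequentially. c < ((\<lambda>e. semidist (A e) B) \<circ> e) n" by simp
  next
    fix c :: ereal assume "0 < c"
    show "\<forall>\<^sub>F n in sequentially. ((\<lambda>e. semidist (A e) B) \<circ> e) n < c"
    proof (rule ccontr)
      assume "\<not> ?thesis"
      from not_eventually_sequentiallyD[OF this] obtain s :: "nat \<Rightarrow> nat"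
        where s: "strict_mono s" and far: "\<And>n. c \<le> semidist (A (e (s n))) B"
        by (auto simp: not_less)
      \<comment> \<open>A real \<open>d\<close> strictly below \<open>c\<close> makes the supremum
        exceed \<open>d\<close> strictly, so some point of the set witnesses it even where the
        supremum is infinite or not attained.\<close>
      obtain d where d: "0 < d" "ereal d < c"
        using ereal_dense2[OF \<open>0 < c\<close>] by auto
      have "\<exists>a\<in>A (e (s n)). ereal d < (INF b\<in>B. ereal (norm (a - b)))" for n
        using less_le_trans[OF d(2) far[of n]] unfolding semidist_def less_SUP_iff .
      then obtain a where a: "\<And>n. a n \<in> A (e (s n))"
        and ad: "\<And>n. ereal d < (INF b\<in>B. ereal (norm (a n - b)))"
        by metis
      have "(e \<circ> s) \<longlonglongrightarrow> e0" using e s by (rule LIMSEQ_subseq_LIMSEQ)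
      with limits[of "e \<circ> s" a] a eI obtain r :: "nat \<Rightarrow> nat" and l
        where l: "(a \<circ> r) \<longlonglongrightarrow> l" "l \<in> B" by auto
      \<comment> \<open>The clash: \<open>a (r n)\<close> comes within \<open>d\<close> of
        \<open>l\<close>, although every point of \<open>B\<close>, including \<open>l\<close>, is
        farther than \<open>d\<close> from it.\<close>
      obtain n where "dist (a (r n)) l < d"
        using tendstoD[OF l(1) d(1)] by (auto dest: eventually_happens)
      moreover have "ereal d < ereal (norm (a (r n) - l))"
        using ad[of "r n"] INF_lower[OF l(2)] by (rule less_le_trans)
      ultimately show False by (simp add: dist_norm)
    qed
  qed
qed

text \<open>If \<open>a\<close> were outside the closed set, a ball of some radius \<open>d\<close>
  around it would miss \<open>A\<close>, and every \<open>S t\<close> containing \<open>a\<close>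
  would have semi-distance at least \<open>d\<close> to \<open>A\<close>.\<close>

lemma mem_of_semidist_tendsto_zero:
  assumes lim: "((\<lambda>t. semidist (S t) A) \<longlongrightarrow> 0) F" and "F \<noteq> bot"
    and mem: "\<forall>\<^sub>F t in F. a \<in> S t" and "closed A"
  shows "a \<in> A"
proof (rule ccontr)
  assume "a \<notin> A"
  then obtain d where d: "0 < d" "ball a d \<subseteq> - A"
    using \<open>closed A\<close> by (meson ComplI open_Compl open_contains_ball)
  have gap: "ereal d \<le> (INF b\<in>A. ereal (norm (a - b)))"
    using d(2) by (intro INF_greatest) (force simp: dist_norm)
  have "\<forall>\<^sub>F t in F. semidist (S t) A < ereal d"
    using order_tendstoD(2)[OF lim, of "ereal d"] d(1) by simp
  with mem have "\<forall>\<^sub>F t in F. False"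
  proof eventually_elim
    case (elim t)
    have "ereal d \<le> semidist (S t) A"
      unfolding semidist_def using elim(1) gap by (rule SUP_upper2)
    with elim(2) show ?case by simp
  qed
  then show False using \<open>F \<noteq> bot\<close> by (simp add: eventually_False)
qed

section \<open>Invariance, absorption, and limits of attractor points\<close>

lemma (in measurable_dynamical_system) shift_in_space:
  assumes "\<omega> \<in> space M"
  shows "\<theta> t \<omega> \<in> space M"
  using measurable_space[OF shift_measurable, of "(t, \<omega>)"] assms
  by (simp add: space_pair_measure)

lemma (in measurable_dynamical_system) shift_inverse:
  assumes "\<omega> \<in> space M"
  shows "\<theta> t (\<theta> (- t) \<omega>) = \<omega>"
  using shift_add[OF assms, of t "- t"] shift_zero[OF assms] by simp

text \<open>Invariance read backwards: started at time \<open>\<tau> - t\<close> from the sample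
  \<open>\<theta> (- t) \<omega>\<close>, the flow arrives at \<open>\<tau>\<close> and
  \<open>\<omega>\<close>. Hence each attractor point has a preimage in the attractor a time
  \<open>t\<close> earlier.\<close>

lemma (in measurable_dynamical_system) pullback_attractor_X_pullback:
  assumes "pullback_attractor_X M \<theta> \<phi> D A" and "\<omega> \<in> space M" and "0 \<le> t"
  shows "A \<tau> \<omega> = \<phi> t (\<tau> - t) (\<theta> (- t) \<omega>) ` A (\<tau> - t) (\<theta> (- t) \<omega>)"
proof -
  have "\<phi> t (\<tau> - t) (\<theta> (- t) \<omega>) ` A (\<tau> - t) (\<theta> (- t) \<omega>) = A (\<tau> - t + t) (\<theta> t (\<theta> (- t) \<omega>))"
    using assms shift_in_space unfolding pullback_attractor_X_def by blast
  then show ?thesis using shift_inverse[OF assms(2)] by simp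
qed

text \<open>The attractor is itself a member of \<open>D\<close>, hence absorbed by
  \<open>K\<close>; by invariance its pulled-back image is the attractor again.\<close>

lemma (in measurable_dynamical_system) attractor_subset_absorbing:
  assumes attr: "pullback_attractor_X M \<theta> \<phi> D A" and absorb: "pullback_absorbing M \<theta> \<phi> D K"
    and \<omega>: "\<omega> \<in> space M"
  shows "A \<tau> \<omega> \<subseteq> K \<tau> \<omega>"
proof -
  have "A \<in> D" using attr by (simp add: pullback_attractor_X_def)
  then obtain T where T: "T > 0"
    "\<phi> T (\<tau> - T) (\<theta> (- T) \<omega>) ` A (\<tau> - T) (\<theta> (- T) \<omega>) \<subseteq> K \<tau> \<omega>"
    using absorb \<omega> unfolding pullback_absorbing_def by (meson order_refl)
  then show ?thesis using pullback_attractor_X_pullback[OF attr \<omega>, of T \<tau>] by simp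
qed

text \<open>The limsup bound gives eventual bounds only by numbers \<open>r\<close> strictly above
  \<open>R\<close>; each passes to the limit of the norms, and then \<open>r\<close> decreases to
  \<open>R\<close>.\<close>

lemma norm_limit_le_Limsup_set_norm:
  fixes x :: "nat \<Rightarrow> 'a::real_normed_vector"
  assumes bound: "Limsup F (\<lambda>e. set_norm (S e)) \<le> ereal R"
    and e: "filterlim e F sequentially" and x: "\<And>n. x n \<in> S (e n)" and l: "x \<longlonglongrightarrow> l"
  shows "norm l \<le> R"
proof (rule dense_ge)
  fix r assume "R < r"
  with bound have "Limsup F (\<lambda>e. set_norm (S e)) < ereal r"
    by (simp add: le_less_trans)
  then have "\<forall>\<^sub>F e in F. set_norm (S e) < ereal r" by (rule Limsup_lessD)
  then have "\<forall>\<^sub>F n in sequentially. set_norm (S (e n)) < ereal r"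
    using e by (rule eventually_compose_filterlim)
  then have "\<forall>\<^sub>F n in sequentially. norm (x n) \<le> r"
  proof eventually_elim
    case (elim n)
    have "ereal (norm (x n)) \<le> set_norm (S (e n))"
      unfolding set_norm_def using x by (rule SUP_upper)
    then have "ereal (norm (x n)) < ereal r" using elim by (rule le_less_trans)
    then show ?case by simp
  qed
  then show "norm l \<le> r"
    using tendsto_norm[OF l] by (intro tendsto_upperbound) auto
qed

text \<open>All the dynamics is concentrated here, for a sequence that already converges; the
  theorem then only has to extract subsequences.\<close>

lemma attractor_limit_mem:
  fixes \<phi> :: "real \<Rightarrow> real \<Rightarrow> real \<Rightarrow> 'w \<Rightarrow> 'x::banach \<Rightarrow> 'x" and e :: "nat \<Rightarrow> real"
  assumes mds: "measurable_dynamical_system M \<theta>"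
    and attractor: "\<And>\<epsilon>. \<epsilon> \<in> I - {\<epsilon>\<^sub>0} \<Longrightarrow> pullback_attractor_X M \<theta> (\<phi> \<epsilon>) (\<D> \<epsilon>) (\<A> \<epsilon>)"
    and attractor0: "deterministic_pullback_attractor_X \<phi>\<^sub>0 \<D>\<^sub>0 \<A>\<^sub>0"
    and conv: "\<And>t \<tau> \<omega> (e :: nat \<Rightarrow> real) (xs :: nat \<Rightarrow> 'x) x.
        0 \<le> t \<Longrightarrow> \<omega> \<in> space M \<Longrightarrow> (\<And>n. e n \<in> I - {\<epsilon>\<^sub>0}) \<Longrightarrow> e \<longlonglongrightarrow> \<epsilon>\<^sub>0 \<Longrightarrow> xs \<longlonglongrightarrow> x \<Longrightarrow>
        (\<lambda>n. \<phi> (e n) t (\<tau> - t) (\<theta> (- t) \<omega>) (xs n)) \<longlonglongrightarrow> \<phi>\<^sub>0 t (\<tau> - t) x"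
    and ball: "(\<lambda>\<tau>. {x. norm x \<le> R' \<tau>}) \<in> \<D>\<^sub>0"
    and absorbing: "\<And>\<epsilon>. \<epsilon> \<in> I - {\<epsilon>\<^sub>0} \<Longrightarrow> pullback_absorbing M \<theta> (\<phi> \<epsilon>) (\<D> \<epsilon>) (K \<epsilon>)"
    and limsup: "\<And>\<tau> \<omega>. \<omega> \<in> space M \<Longrightarrow>
        Limsup (at \<epsilon>\<^sub>0 within I) (\<lambda>\<epsilon>. set_norm (K \<epsilon> \<tau> \<omega>)) \<le> ereal (R' \<tau>)"
    and precompact: "\<And>\<tau> \<omega>. \<omega> \<in> space M \<Longrightarrow> compact (closure (\<Union>\<epsilon>\<in>I - {\<epsilon>\<^sub>0}. \<A> \<epsilon> \<tau> \<omega>))"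
    and \<omega>: "\<omega> \<in> space M" and eI: "\<And>n. e n \<in> I - {\<epsilon>\<^sub>0}" and e: "e \<longlonglongrightarrow> \<epsilon>\<^sub>0"
    and a: "\<And>n. a n \<in> \<A> (e n) \<tau> \<omega>" and l: "a \<longlonglongrightarrow> l"
  shows "l \<in> \<A>\<^sub>0 \<tau>"
proof -
  interpret measurable_dynamical_system M \<theta> by (rule mds)
  have image: "l \<in> \<phi>\<^sub>0 t (\<tau> - t) ` {x. norm x \<le> R' (\<tau> - t)}" if t: "0 \<le> t" for t
  proof -
    let ?\<omega> = "\<theta> (- t) \<omega>"
    have \<omega>': "?\<omega> \<in> space M" using \<omega> by (rule shift_in_space)
    have "\<exists>x\<in>\<A> (e n) (\<tau> - t) ?\<omega>. a n = \<phi> (e n) t (\<tau> - t) ?\<omega> x" for n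
      using pullback_attractor_X_pullback[OF attractor[OF eI] \<omega> t] a[of n] by blast
    then obtain x where x: "\<And>n. x n \<in> \<A> (e n) (\<tau> - t) ?\<omega>"
      and ax: "\<And>n. a n = \<phi> (e n) t (\<tau> - t) ?\<omega> (x n)"
      by metis
    \<comment> \<open>Precompactness is used at the earlier time and the shifted sample. The
      subsequence may depend on \<open>t\<close>, because \<open>a\<close> itself converges and so
      every subsequence of it has the limit \<open>l\<close>.\<close>
    have "x n \<in> (\<Union>\<epsilon>\<in>I - {\<epsilon>\<^sub>0}. \<A> \<epsilon> (\<tau> - t) ?\<omega>)" for n
      using x[of n] eI[of n] by blast
    with precompact[OF \<omega>'] obtain r z where r: "strict_mono r" and z: "(x \<circ> r) \<longlonglongrightarrow> z"
      by (rule precompact_convergent_subseq)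
    have er: "(e \<circ> r) \<longlonglongrightarrow> \<epsilon>\<^sub>0" using e r by (rule LIMSEQ_subseq_LIMSEQ)
    \<comment> \<open>The filter of the limsup is punctured at \<open>\<epsilon>\<^sub>0\<close>;
      the parameters avoid that point by \<open>eI\<close>.\<close>
    have "filterlim (e \<circ> r) (at \<epsilon>\<^sub>0 within I) sequentially"
      using er eI by (auto simp: filterlim_at)
    moreover have "(x \<circ> r) n \<in> K ((e \<circ> r) n) (\<tau> - t) ?\<omega>" for n
      using attractor_subset_absorbing[OF attractor absorbing \<omega>', OF eI eI] x by auto
    ultimately have "norm z \<le> R' (\<tau> - t)"
      using norm_limit_le_Limsup_set_norm[OF limsup[OF \<omega>']] z by blast
    moreover have "(a \<circ> r) \<longlonglongrightarrow> \<phi>\<^sub>0 t (\<tau> - t) z"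
      using conv[OF t \<omega> _ er z] eI by (simp add: ax o_def)
    then have "l = \<phi>\<^sub>0 t (\<tau> - t) z"
      using LIMSEQ_subseq_LIMSEQ[OF l r] LIMSEQ_unique by blast
    ultimately show ?thesis by blast
  qed
  \<comment> \<open>The balls form a member of \<open>\<D>\<^sub>0\<close>, so they are attracted,
    and by \<open>image\<close> the fixed point \<open>l\<close> lies in all their pulled-back
    images.\<close>
  have "((\<lambda>t. semidist (\<phi>\<^sub>0 t (\<tau> - t) ` {x. norm x \<le> R' (\<tau> - t)}) (\<A>\<^sub>0 \<tau>)) \<longlongrightarrow> 0) at_top"
    using attractor0[unfolded deterministic_pullback_attractor_X_def, THEN conjunct2, THEN conjunct2,
        THEN conjunct2, rule_format, OF ball] .
  moreover have "\<forall>\<^sub>F t in at_top. l \<in> \<phi>\<^sub>0 t (\<tau> - t) ` {x. norm x \<le> R' (\<tau> - t)}"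
    using eventually_ge_at_top[of 0] image by (rule eventually_mono)
  moreover have "closed (\<A>\<^sub>0 \<tau>)"
    using attractor0 by (auto simp: deterministic_pullback_attractor_X_def intro: compact_imp_closed)
  ultimately show ?thesis
    by (rule mem_of_semidist_tendsto_zero[OF _ trivial_limit_at_top_linorder])
qed

section \<open>Upper semicontinuity in X, then in Y\<close>

theorem theorem2p8:
  fixes iX :: "'x::banach \<Rightarrow> 'u" and iY :: "'y::banach \<Rightarrow> 'u"
    and M :: "'w measure" and \<theta> :: "real \<Rightarrow> 'w \<Rightarrow> 'w"
    and I :: "real set" and \<epsilon>\<^sub>0 :: real
    and \<D> :: "real \<Rightarrow> (real \<Rightarrow> 'w \<Rightarrow> 'x set) set"
    and \<phi> :: "real \<Rightarrow> real \<Rightarrow> real \<Rightarrow> 'w \<Rightarrow> 'x \<Rightarrow> 'x"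
    and \<A> :: "real \<Rightarrow> real \<Rightarrow> 'w \<Rightarrow> 'x set"
    and \<D>\<^sub>0 :: "(real \<Rightarrow> 'x set) set"
    and \<phi>\<^sub>0 :: "real \<Rightarrow> real \<Rightarrow> 'x \<Rightarrow> 'x"
    and \<A>\<^sub>0 :: "real \<Rightarrow> 'x set"
    and R' :: "real \<Rightarrow> real"
    and K :: "real \<Rightarrow> real \<Rightarrow> 'w \<Rightarrow> 'x set"
  assumes sep_X: "separable_space (euclidean :: 'x topology)"
    and sep_Y: "separable_space (euclidean :: 'y topology)"
    and inj: "inj iX" "inj iY"
    and common: "range iX \<inter> range iY \<noteq> {}"
    and mds: "measurable_dynamical_system M \<theta>"
    and limit_point: "\<epsilon>\<^sub>0 islimpt I"
    and D_nonempty: "\<forall>\<epsilon>\<in>I - {\<epsilon>\<^sub>0}. \<forall>B\<in>\<D> \<epsilon>. \<forall>\<tau>. \<forall>\<omega>\<in>space M. B \<tau> \<omega> \<noteq> {}"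
    and cocycle: "\<forall>\<epsilon>\<in>I - {\<epsilon>\<^sub>0}. continuous_cocycle M \<theta> (\<phi> \<epsilon>)"
    and attractor_X: "\<forall>\<epsilon>\<in>I - {\<epsilon>\<^sub>0}. pullback_attractor_X M \<theta> (\<phi> \<epsilon>) (\<D> \<epsilon>) (\<A> \<epsilon>)"
    and attractor_Y: "\<forall>\<epsilon>\<in>I - {\<epsilon>\<^sub>0}. pullback_attractor_Y iX iY M \<theta> (\<phi> \<epsilon>) (\<D> \<epsilon>) (\<A> \<epsilon>)"
    and D0_nonempty: "\<forall>B\<in>\<D>\<^sub>0. \<forall>\<tau>. B \<tau> \<noteq> {}"
    and cocycle0: "deterministic_continuous_cocycle \<phi>\<^sub>0"
    and attractor0_X: "deterministic_pullback_attractor_X \<phi>\<^sub>0 \<D>\<^sub>0 \<A>\<^sub>0"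
    and attractor0_Y: "deterministic_pullback_attractor_Y iX iY \<phi>\<^sub>0 \<D>\<^sub>0 \<A>\<^sub>0"
    and C1: "\<forall>t\<ge>0. \<forall>\<tau>. \<forall>\<omega>\<in>space M. \<forall>(e :: nat \<Rightarrow> real) (xs :: nat \<Rightarrow> 'x) x.
        (\<forall>n. e n \<in> I - {\<epsilon>\<^sub>0}) \<longrightarrow> e \<longlonglongrightarrow> \<epsilon>\<^sub>0 \<longrightarrow> xs \<longlonglongrightarrow> x \<longrightarrow>
        (\<lambda>n. \<phi> (e n) t (\<tau> - t) (\<theta> (- t) \<omega>) (xs n)) \<longlonglongrightarrow> \<phi>\<^sub>0 t (\<tau> - t) x"
    and C2: "(\<lambda>\<tau>. {x. norm x \<le> R' \<tau>}) \<in> \<D>\<^sub>0"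
    and C3_absorbing: "\<forall>\<epsilon>\<in>I - {\<epsilon>\<^sub>0}. closed_family M (K \<epsilon>) \<and> measurable_family M (K \<epsilon>) \<and>
        pullback_absorbing M \<theta> (\<phi> \<epsilon>) (\<D> \<epsilon>) (K \<epsilon>)"
    and C3_limsup: "\<forall>\<tau>. \<forall>\<omega>\<in>space M.
        Limsup (at \<epsilon>\<^sub>0 within I) (\<lambda>\<epsilon>. set_norm (K \<epsilon> \<tau> \<omega>)) \<le> ereal (R' \<tau>)"
    and C4: "\<forall>\<tau>. \<forall>\<omega>\<in>space M. compact (closure (\<Union>\<epsilon>\<in>I - {\<epsilon>\<^sub>0}. \<A> \<epsilon> \<tau> \<omega>))"
  shows "(\<forall>\<tau>. \<forall>\<omega>\<in>space M.
            ((\<lambda>\<epsilon>. semidist (\<A> \<epsilon> \<tau> \<omega>) (\<A>\<^sub>0 \<tau>)) \<longlongrightarrow> 0) (at \<epsilon>\<^sub>0 within I)) \<and>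
         ((\<forall>\<tau>. \<forall>\<omega>\<in>space M.
              compact (closure (trace_in_Y iX iY (\<Union>\<epsilon>\<in>I - {\<epsilon>\<^sub>0}. \<A> \<epsilon> \<tau> \<omega>)))) \<and>
          (\<forall>\<epsilon>\<in>I - {\<epsilon>\<^sub>0}. \<forall>t>0. \<forall>\<tau>. \<forall>\<omega>\<in>space M. contained_in_Y iX iY (range (\<phi> \<epsilon> t \<tau> \<omega>))) \<and>
          (\<forall>t>0. \<forall>\<tau>. contained_in_Y iX iY (range (\<phi>\<^sub>0 t \<tau>))) \<and>
          (\<forall>(xs :: nat \<Rightarrow> 'x) (ys :: nat \<Rightarrow> 'y) x y.
              (\<forall>n. iX (xs n) = iY (ys n)) \<longrightarrow> xs \<longlonglongrightarrow> x \<longrightarrow> ys \<longlonglongrightarrow> y \<longrightarrow> iX x = iY y)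
          \<longrightarrow>
          (\<forall>\<tau>. \<forall>\<omega>\<in>space M.
             ((\<lambda>\<epsilon>. semidist (trace_in_Y iX iY (\<A> \<epsilon> \<tau> \<omega>)) (trace_in_Y iX iY (\<A>\<^sub>0 \<tau>)))
                \<longlongrightarrow> 0) (at \<epsilon>\<^sub>0 within I)))"
proof -
  have nonempty: "\<A> \<epsilon> \<tau> \<omega> \<noteq> {}" if "\<epsilon> \<in> I - {\<epsilon>\<^sub>0}" "\<omega> \<in> space M" for \<epsilon> \<tau> \<omega>
    using attractor_X D_nonempty that by (auto simp: pullback_attractor_X_def)
  have absorbing: "pullback_absorbing M \<theta> (\<phi> \<epsilon>) (\<D> \<epsilon>) (K \<epsilon>)" if "\<epsilon> \<in> I - {\<epsilon>\<^sub>0}" for \<epsilon>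
    using C3_absorbing that by blast
  \<comment> \<open>This has the shape required by \<open>semidist_tendsto_zeroI\<close>. It settles
    X directly and is used again in Y to identify limits.\<close>
  have limits: "\<exists>r l. strict_mono (r :: nat \<Rightarrow> nat) \<and> (a \<circ> r) \<longlonglongrightarrow> l \<and> l \<in> \<A>\<^sub>0 \<tau>"
    if \<omega>: "\<omega> \<in> space M" and eI: "\<And>n. e n \<in> I - {\<epsilon>\<^sub>0}" and e: "e \<longlonglongrightarrow> \<epsilon>\<^sub>0"
      and a: "\<And>n. a n \<in> \<A> (e n) \<tau> \<omega>" for \<tau> \<omega> e a
  proof -
    have "compact (closure (\<Union>\<epsilon>\<in>I - {\<epsilon>\<^sub>0}. \<A> \<epsilon> \<tau> \<omega>))"
      using C4 \<omega> by blast
    moreover have "a n \<in> (\<Union>\<epsilon>\<in>I - {\<epsilon>\<^sub>0}. \<A> \<epsilon> \<tau> \<omega>)" for n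
      using a[of n] eI[of n] by blast
    ultimately obtain r l where r: "strict_mono r" and l: "(a \<circ> r) \<longlonglongrightarrow> l"
      by (rule precompact_convergent_subseq)
    have "l \<in> \<A>\<^sub>0 \<tau>"
    proof (rule attractor_limit_mem[OF mds attractor_X[rule_format] attractor0_X C1[rule_format] C2
            absorbing C3_limsup[rule_format] C4[rule_format] \<omega>])
      show "(e \<circ> r) \<longlonglongrightarrow> \<epsilon>\<^sub>0" using e r by (rule LIMSEQ_subseq_LIMSEQ)
      show "(a \<circ> r) n \<in> \<A> ((e \<circ> r) n) \<tau> \<omega>" for n using a by simp
      show "(e \<circ> r) n \<in> I - {\<epsilon>\<^sub>0}" for n using eI by simp
    qed (assumption | rule l)+
    with r l show ?thesis by blast
  qed
  show ?thesis
  proof (intro conjI impI allI ballI, goal_cases)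
    case (1 \<tau> \<omega>)
    show ?case
      by (rule semidist_tendsto_zeroI[OF nonempty[OF _ 1] limits[OF 1]])
  next
    case (2 \<tau> \<omega>)
    have C5: "compact (closure (trace_in_Y iX iY (\<Union>\<epsilon>\<in>I - {\<epsilon>\<^sub>0}. \<A> \<epsilon> \<tau> \<omega>)))"
      using 2(1)[THEN conjunct1] 2(2) by blast
    have compatible: "\<And>(xs :: nat \<Rightarrow> 'x) (ys :: nat \<Rightarrow> 'y) x y.
        (\<And>n. iX (xs n) = iY (ys n)) \<Longrightarrow> xs \<longlonglongrightarrow> x \<Longrightarrow> ys \<longlonglongrightarrow> y \<Longrightarrow> iX x = iY y"
      by (rule 2(1)[THEN conjunct2, THEN conjunct2, THEN conjunct2, rule_format])
    show ?case
    proof (rule semidist_tendsto_zeroI)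
      fix \<epsilon> assume \<epsilon>: "\<epsilon> \<in> I - {\<epsilon>\<^sub>0}"
      then have "contained_in_Y iX iY (\<A> \<epsilon> \<tau> \<omega>)"
        using attractor_Y 2(2) by (auto simp: pullback_attractor_Y_def)
      with nonempty[OF \<epsilon> 2(2), of \<tau>] show "trace_in_Y iX iY (\<A> \<epsilon> \<tau> \<omega>) \<noteq> {}"
        by (rule trace_in_Y_nonempty[rotated])
    next
      fix e :: "nat \<Rightarrow> real" and b
      assume eI: "\<And>n. e n \<in> I - {\<epsilon>\<^sub>0}" and e: "e \<longlonglongrightarrow> \<epsilon>\<^sub>0"
        and b: "\<And>n. b n \<in> trace_in_Y iX iY (\<A> (e n) \<tau> \<omega>)"
      \<comment> \<open>Each \<open>b n\<close> is an attractor point seen in Y; \<open>a n\<close>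
        is the same point of the common universe seen in X.\<close>
      have "\<exists>a\<in>\<A> (e n) \<tau> \<omega>. iX a = iY (b n)" for n
        using b[of n] by (force simp: trace_in_Y_def)
      then obtain a where a: "\<And>n. a n \<in> \<A> (e n) \<tau> \<omega>" and ab: "\<And>n. iX (a n) = iY (b n)"
        by metis
      have "b n \<in> trace_in_Y iX iY (\<Union>\<epsilon>\<in>I - {\<epsilon>\<^sub>0}. \<A> \<epsilon> \<tau> \<omega>)" for n
        using b[of n] eI[of n] by (auto simp: trace_in_Y_def)
      with C5 obtain r y where r: "strict_mono r" and y: "(b \<circ> r) \<longlonglongrightarrow> y"
        by (rule precompact_convergent_subseq)
      \<comment> \<open>The subsequence \<open>r\<close> converges in Y; a second extraction
        \<open>s\<close> adds convergence in X, with a limit already known to lie in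
        \<open>\<A>\<^sub>0 \<tau>\<close>.\<close>
      have "\<exists>s l. strict_mono (s :: nat \<Rightarrow> nat) \<and> (a \<circ> r \<circ> s) \<longlonglongrightarrow> l \<and> l \<in> \<A>\<^sub>0 \<tau>"
      proof (rule limits[OF 2(2)])
        show "(e \<circ> r) \<longlonglongrightarrow> \<epsilon>\<^sub>0" using e r by (rule LIMSEQ_subseq_LIMSEQ)
        show "(a \<circ> r) n \<in> \<A> ((e \<circ> r) n) \<tau> \<omega>" for n using a by simp
        show "(e \<circ> r) n \<in> I - {\<epsilon>\<^sub>0}" for n using eI by simp
      qed
      then obtain s :: "nat \<Rightarrow> nat" and x
        where s: "strict_mono s" and x: "(a \<circ> r \<circ> s) \<longlonglongrightarrow> x" "x \<in> \<A>\<^sub>0 \<tau>"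
        by blast
      have ys: "(b \<circ> r \<circ> s) \<longlonglongrightarrow> y" using y s by (rule LIMSEQ_subseq_LIMSEQ)
      \<comment> \<open>Compatibility of the two convergences makes both limits one point of the
        universe, which carries membership in \<open>\<A>\<^sub>0 \<tau>\<close> over to
        \<open>y\<close>.\<close>
      have "iX x = iY y" by (rule compatible[OF _ x(1) ys]) (simp add: ab)
      with x(2) have "y \<in> trace_in_Y iX iY (\<A>\<^sub>0 \<tau>)"
        unfolding trace_in_Y_def by (auto intro: rev_image_eqI)
      moreover have "strict_mono (r \<circ> s)" using r s by (rule strict_mono_o)
      moreover have "(b \<circ> (r \<circ> s)) \<longlonglongrightarrow> y" using ys by (simp only: comp_assoc)
      ultimately show "\<exists>r l. strict_mono (r :: nat \<Rightarrow> nat) \<and> (b \<circ> r) \<longlonglongrightarrow> l \<and>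
          l \<in> trace_in_Y iX iY (\<A>\<^sub>0 \<tau>)"
        by blast
    qed
  qed
qed

end
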